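(* Let $G$ be a group with neutral element $e$ and let $S=\bigoplus_{g\in G}S_g$ be an epsilon-strongly $G$-graded ring. Then $S$ is graded von Neumann regular if and only if $S_e$ is von Neumann regular.
   Context: Rings are associative. A $G$-grading of a ring $S$ is a collection $\{S_g\}_{g\in G}$ of additive subgroups of $S$ with $S=\bigoplus_{g\in G}S_g$ and $S_gS_h\subseteq S_{gh}$ for all $g,h\in G$. For additive subgroups $A,B\subseteq S$, $AB$ denotes the set of finite sums of products $ab$ with $a\in A$, $b\in B$. The $G$-graded ring $S$ is epsilon-strongly $G$-graded if for every $g\in G$ there is an element $\epsilon_g\in S_gS_{g^{-1}}$ such that $\epsilon_g s=s=s\epsilon_{g^{-1}}$ for every $s\in S_g$. A ring $R$ is von Neumann regular if for every $x\in R$ there is $y\in R$ with $x=xyx$. The $G$-graded ring $S$ is graded von Neumann regular if for every $g\in G$ and every $a\in S_g$ there is $s\in S$ with $a=asa$. *)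

theory Defs
  imports "HOL-Algebra.Algebra"
begin

text \<open>
  Associative rings, not assumed to have an identity. The field \<open>one\<close> of the ring record
  plays no role below.
\<close>

locale nonunital_ring = abelian_group R for R (structure) +
  assumes m_closed: "\<lbrakk>x \<in> carrier R; y \<in> carrier R\<rbrakk> \<Longrightarrow> x \<otimes> y \<in> carrier R"
    and m_assoc: "\<lbrakk>x \<in> carrier R; y \<in> carrier R; z \<in> carrier R\<rbrakk>
      \<Longrightarrow> (x \<otimes> y) \<otimes> z = x \<otimes> (y \<otimes> z)"
    and l_distr: "\<lbrakk>x \<in> carrier R; y \<in> carrier R; z \<in> carrier R\<rbrakk>
      \<Longrightarrow> (x \<oplus> y) \<otimes> z = x \<otimes> z \<oplus> y \<otimes> z"
    and r_distr: "\<lbrakk>x \<in> carrier R; y \<in> carrier R; z \<in> carrier R\<rbrakk>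
      \<Longrightarrow> z \<otimes> (x \<oplus> y) = z \<otimes> x \<oplus> z \<otimes> y"

lemma ring_imp_nonunital_ring:
  assumes "ring R"
  shows "nonunital_ring R"
proof -
  interpret ring R by fact
  show ?thesis
    by unfold_locales (auto simp: m_assoc l_distr r_distr)
qed

definition finite_sums_of_products :: "('a, 'm) ring_scheme \<Rightarrow> 'a set \<Rightarrow> 'a set \<Rightarrow> 'a set" where
  "finite_sums_of_products R A B =
    {\<Oplus>\<^bsub>R\<^esub>i\<in>{..<n}. a i \<otimes>\<^bsub>R\<^esub> b i | (n::nat) a b. a \<in> {..<n} \<rightarrow> A \<and> b \<in> {..<n} \<rightarrow> B}"

text \<open>
  \<open>C g\<close> is the homogeneous component of degree \<open>g\<close>. The assumption \<open>direct_sum\<close> says that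
  \<open>S\<close> is the internal direct sum of the \<open>C g\<close>; the family \<open>c\<close> is taken in the extensional
  product \<open>PiE\<close> so that its irrelevant values outside \<open>carrier G\<close> do not spoil uniqueness.
\<close>

locale graded_ring = G: group G + S: nonunital_ring S
  for G :: "('g, 'k) monoid_scheme" and S :: "('a, 'm) ring_scheme" +
  fixes C :: "'g \<Rightarrow> 'a set"
  assumes component_subgroup: "g \<in> carrier G \<Longrightarrow> additive_subgroup (C g) S"
    and direct_sum: "x \<in> carrier S \<Longrightarrow>
      \<exists>!c. c \<in> (\<Pi>\<^sub>E g\<in>carrier G. C g) \<and>
           finite {g \<in> carrier G. c g \<noteq> \<zero>\<^bsub>S\<^esub>} \<and>
           x = (\<Oplus>\<^bsub>S\<^esub>g\<in>{g \<in> carrier G. c g \<noteq> \<zero>\<^bsub>S\<^esub>}. c g)"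
    and component_mult: "\<lbrakk>g \<in> carrier G; h \<in> carrier G\<rbrakk> \<Longrightarrow>
      finite_sums_of_products S (C g) (C h) \<subseteq> C (g \<otimes>\<^bsub>G\<^esub> h)"

definition epsilon_strongly_graded ::
  "('g, 'k) monoid_scheme \<Rightarrow> ('a, 'm) ring_scheme \<Rightarrow> ('g \<Rightarrow> 'a set) \<Rightarrow> bool" where
  "epsilon_strongly_graded G S C \<longleftrightarrow>
    graded_ring G S C \<and>
    (\<exists>\<epsilon>. \<forall>g\<in>carrier G.
      \<epsilon> g \<in> finite_sums_of_products S (C g) (C (inv\<^bsub>G\<^esub> g)) \<and>
      (\<forall>s\<in>C g. \<epsilon> g \<otimes>\<^bsub>S\<^esub> s = s \<and> s = s \<otimes>\<^bsub>S\<^esub> \<epsilon> (inv\<^bsub>G\<^esub> g)))"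

definition von_neumann_regular :: "('a, 'm) ring_scheme \<Rightarrow> bool" where
  "von_neumann_regular R \<longleftrightarrow>
    (\<forall>x\<in>carrier R. \<exists>y\<in>carrier R. x = x \<otimes>\<^bsub>R\<^esub> y \<otimes>\<^bsub>R\<^esub> x)"

definition graded_von_neumann_regular ::
  "('g, 'k) monoid_scheme \<Rightarrow> ('a, 'm) ring_scheme \<Rightarrow> ('g \<Rightarrow> 'a set) \<Rightarrow> bool" where
  "graded_von_neumann_regular G S C \<longleftrightarrow>
    (\<forall>g\<in>carrier G. \<forall>a\<in>C g. \<exists>s\<in>carrier S. a = a \<otimes>\<^bsub>S\<^esub> s \<otimes>\<^bsub>S\<^esub> a)"

text \<open>
  Only the component of the neutral element is a ring in general. Its inherited \<open>one\<close> field
  is again irrelevant.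
\<close>

definition component_ring :: "('a, 'm) ring_scheme \<Rightarrow> ('g \<Rightarrow> 'a set) \<Rightarrow> 'g \<Rightarrow> ('a, 'm) ring_scheme" where
  "component_ring S C g = S\<lparr>carrier := C g\<rparr>"

lemma (in graded_ring) mult_in_component:
  assumes "g \<in> carrier G" "h \<in> carrier G" "x \<in> C g" "y \<in> C h"
  shows "x \<otimes>\<^bsub>S\<^esub> y \<in> C (g \<otimes>\<^bsub>G\<^esub> h)"
proof -
  have xy: "x \<in> carrier S" "y \<in> carrier S"
    using assms component_subgroup additive_subgroup.a_Hcarr by metis+
  have "x \<otimes>\<^bsub>S\<^esub> y = (\<Oplus>\<^bsub>S\<^esub>i\<in>{..<1::nat}. x \<otimes>\<^bsub>S\<^esub> y)"
    using xy by (simp add: S.m_closed lessThan_Suc)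
  then have "x \<otimes>\<^bsub>S\<^esub> y \<in> finite_sums_of_products S (C g) (C h)"
    unfolding finite_sums_of_products_def using assms
    by (intro CollectI exI[of _ "1::nat"] exI[of _ "\<lambda>_. x"] exI[of _ "\<lambda>_. y"]) auto
  then show ?thesis
    using component_mult assms by blast
qed

lemma (in graded_ring) nonunital_ring_component_one:
  "nonunital_ring (component_ring S C \<one>\<^bsub>G\<^esub>)"
proof -
  interpret H: additive_subgroup "C \<one>\<^bsub>G\<^esub>" S
    by (simp add: component_subgroup)
  have "group ((add_monoid S)\<lparr>carrier := C \<one>\<^bsub>G\<^esub>\<rparr>)"
    using S.add.is_group by (rule subgroup.subgroup_is_group[OF H.a_subgroup])
  then have "comm_group ((add_monoid S)\<lparr>carrier := C \<one>\<^bsub>G\<^esub>\<rparr>)"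
    by (rule group.group_comm_groupI) (simp add: H.a_Hcarr S.a_comm)
  then have "abelian_group (component_ring S C \<one>\<^bsub>G\<^esub>)"
    unfolding component_ring_def
    by (auto simp: abelian_group_def abelian_monoid_def abelian_group_axioms_def comm_group_def)
  moreover have "x \<otimes>\<^bsub>S\<^esub> y \<in> C \<one>\<^bsub>G\<^esub>" if "x \<in> C \<one>\<^bsub>G\<^esub>" "y \<in> C \<one>\<^bsub>G\<^esub>" for x y
    using mult_in_component[OF _ _ that] by simp
  ultimately show ?thesis
    unfolding nonunital_ring_def nonunital_ring_axioms_def
    by (auto simp: component_ring_def S.m_assoc S.l_distr S.r_distr H.a_Hcarr)
qed

end

theory Submission
  imports Defs
begin

text \<open>
  If \<open>a\<close> lies in \<open>S\<^sub>e\<close> and \<open>a = a s a\<close>, comparing components of degree \<open>e\<close> shows that \<open>s\<close> may be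
  replaced by its component in \<open>S\<^sub>e\<close>. Conversely, let \<open>a\<close> have degree \<open>g\<close> and write
  \<open>\<epsilon> g = \<Sum>i. u i v i\<close> with \<open>u i\<close> of degree \<open>g\<close> and \<open>v i\<close> of degree \<open>g\<inverse>\<close>. Regularity of \<open>S\<^sub>e\<close>
  yields, as in the proof that finitely generated left ideals are generated by an idempotent,
  one \<open>w\<close> of degree \<open>g\<inverse>\<close> such that \<open>w a\<close> is a right identity on all the elements \<open>v i a\<close> of
  \<open>S\<^sub>e\<close>. Then \<open>a = \<epsilon> g a = \<Sum>i. u i v i a = \<Sum>i. u i v i a w a = a w a\<close>.
\<close>

lemma (in abelian_group_hom) hom_finsum:
  assumes "finite A" "f \<in> A \<rightarrow> carrier G"
  shows "h (finsum G f A) = (\<Oplus>\<^bsub>H\<^esub>i\<in>A. h (f i))"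
  using assms
proof (induction A)
  case empty
  then show ?case by (simp add: G.finsum_empty H.finsum_empty)
next
  case (insert i A)
  then have "f \<in> A \<rightarrow> carrier G" "f i \<in> carrier G" "(\<lambda>i. h (f i)) \<in> A \<rightarrow> carrier H"
    by (auto intro: hom_closed)
  then show ?case
    using insert by (simp add: G.finsum_insert H.finsum_insert G.finsum_closed)
qed

context nonunital_ring
begin

text \<open>Viewing multiplication by a fixed element as an additive homomorphism yields its
  behaviour on zero, negatives and finite sums from general facts, with no identity element
  involved.\<close>

lemma left_mult_hom: "x \<in> carrier R \<Longrightarrow> abelian_group_hom R R (\<lambda>y. x \<otimes> y)"
  by (intro abelian_group_homI abelian_group_axioms group_hom.intro group_hom_axioms.intro
      a_group homI) (simp_all add: m_closed r_distr)

lemma right_mult_hom: "x \<in> carrier R \<Longrightarrow> abelian_group_hom R R (\<lambda>y. y \<otimes> x)"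
  by (intro abelian_group_homI abelian_group_axioms group_hom.intro group_hom_axioms.intro
      a_group homI) (simp_all add: m_closed l_distr)

lemma l_null: "x \<in> carrier R \<Longrightarrow> \<zero> \<otimes> x = \<zero>"
  using abelian_group_hom.hom_zero[OF right_mult_hom] .

lemma l_minus: "\<lbrakk>x \<in> carrier R; y \<in> carrier R\<rbrakk> \<Longrightarrow> \<ominus> x \<otimes> y = \<ominus> (x \<otimes> y)"
  using abelian_group_hom.hom_a_inv[OF right_mult_hom] .

lemma r_minus: "\<lbrakk>x \<in> carrier R; y \<in> carrier R\<rbrakk> \<Longrightarrow> x \<otimes> \<ominus> y = \<ominus> (x \<otimes> y)"
  using abelian_group_hom.hom_a_inv[OF left_mult_hom] .

lemma l_distr_diff:
  "\<lbrakk>x \<in> carrier R; y \<in> carrier R; z \<in> carrier R\<rbrakk> \<Longrightarrow> (x \<ominus> y) \<otimes> z = x \<otimes> z \<ominus> y \<otimes> z"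
  by (simp add: a_minus_def l_distr l_minus)

lemma r_distr_diff:
  "\<lbrakk>x \<in> carrier R; y \<in> carrier R; z \<in> carrier R\<rbrakk> \<Longrightarrow> z \<otimes> (x \<ominus> y) = z \<otimes> x \<ominus> z \<otimes> y"
  by (simp add: a_minus_def r_distr r_minus)

lemmas finsum_rdistr = abelian_group_hom.hom_finsum[OF left_mult_hom]
lemmas finsum_ldistr = abelian_group_hom.hom_finsum[OF right_mult_hom]

lemma add_diff_cancel_left: "\<lbrakk>x \<in> carrier R; y \<in> carrier R\<rbrakk> \<Longrightarrow> x \<oplus> (y \<ominus> x) = y"
  by (metis a_comm a_minus_def a_inv_closed a_assoc l_neg r_zero)

text \<open>In a unital ring the factor after \<open>p\<close> is \<open>1 - (1 - f) (1 - k)\<close>.\<close>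

lemma mult_circle_composition:
  assumes "p \<in> carrier R" "f \<in> carrier R" "k \<in> carrier R"
  shows "p \<otimes> (f \<oplus> (k \<ominus> f \<otimes> k)) = p \<otimes> f \<oplus> (p \<ominus> p \<otimes> f) \<otimes> k"
  using assms by (simp add: r_distr r_distr_diff l_distr_diff m_closed m_assoc)

end

context graded_ring
begin

lemma component_closed: "\<lbrakk>g \<in> carrier G; x \<in> C g\<rbrakk> \<Longrightarrow> x \<in> carrier S"
  using component_subgroup additive_subgroup.a_Hcarr by metis

lemma component_add:
  "\<lbrakk>g \<in> carrier G; x \<in> C g; y \<in> C g\<rbrakk> \<Longrightarrow> x \<oplus>\<^bsub>S\<^esub> y \<in> C g"
  using component_subgroup additive_subgroup.a_closed by metis

lemma component_diff:
  "\<lbrakk>g \<in> carrier G; x \<in> C g; y \<in> C g\<rbrakk> \<Longrightarrow> x \<ominus>\<^bsub>S\<^esub> y \<in> C g"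
  unfolding a_minus_def
  using component_subgroup additive_subgroup.a_inv_closed component_add by metis

text \<open>This is the comparison of components: \<open>finsum S c F\<close> has two homogeneous
  decompositions, the family \<open>c\<close> and itself placed in degree \<open>g\<close>.
  Uniqueness in \<open>direct_sum\<close> identifies them.\<close>

lemma homogeneous_sum_eq:
  assumes F: "finite F" "F \<subseteq> carrier G" and g: "g \<in> F"
    and c: "\<And>h. h \<in> F \<Longrightarrow> c h \<in> C h" and sum: "finsum S c F \<in> C g"
  shows "finsum S c F = c g"
proof -
  let ?x = "finsum S c F"
  let ?decomposes = "\<lambda>d. d \<in> (\<Pi>\<^sub>E h\<in>carrier G. C h) \<and>
    finite {h \<in> carrier G. d h \<noteq> \<zero>\<^bsub>S\<^esub>} \<and> ?x = (\<Oplus>\<^bsub>S\<^esub>h\<in>{h \<in> carrier G. d h \<noteq> \<zero>\<^bsub>S\<^esub>}. d h)"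
  have zero: "\<zero>\<^bsub>S\<^esub> \<in> C h" if "h \<in> carrier G" for h
    using additive_subgroup.zero_closed[OF component_subgroup[OF that]] .
  \<comment> \<open>Extending by zero turns any finite homogeneous family with sum \<open>?x\<close>
    into a decomposition as in \<open>direct_sum\<close>. Its support can be smaller than
    \<open>A\<close>, since \<open>d\<close> may vanish at some indices; those summands contribute
    nothing.\<close>
  have decomposes: "?decomposes (\<lambda>h\<in>carrier G. if h \<in> A then d h else \<zero>\<^bsub>S\<^esub>)"
    if A: "finite A" "A \<subseteq> carrier G" and d: "\<And>h. h \<in> A \<Longrightarrow> d h \<in> C h" and x: "?x = finsum S d A"
    for A d
  proof -
    define d' where "d' = (\<lambda>h\<in>carrier G. if h \<in> A then d h else \<zero>\<^bsub>S\<^esub>)"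
    have sub: "{h \<in> carrier G. d' h \<noteq> \<zero>\<^bsub>S\<^esub>} \<subseteq> A" by (auto simp: d'_def)
    have "d \<in> A \<rightarrow> carrier S"
      using A d component_closed by blast
    then have "finsum S d A = finsum S d' {h \<in> carrier G. d' h \<noteq> \<zero>\<^bsub>S\<^esub>}"
      using A sub by (intro S.add.finprod_mono_neutral_cong_right) (auto simp: d'_def)
    moreover have "d' \<in> (\<Pi>\<^sub>E h\<in>carrier G. C h)"
      using d zero by (auto simp: d'_def)
    ultimately have "?decomposes d'"
      using x finite_subset[OF sub A(1)] by simp
    then show ?thesis unfolding d'_def .
  qed
  have closed: "?x \<in> carrier S"
    using sum g F component_closed by blast
  have "?x = (\<Oplus>\<^bsub>S\<^esub>h\<in>{g}. ?x)"
    using closed by (simp add: S.finsum_insert S.finsum_empty)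
  then have "?decomposes (\<lambda>h\<in>carrier G. if h \<in> {g} then ?x else \<zero>\<^bsub>S\<^esub>)"
    using g F sum by (intro decomposes) auto
  moreover have "?decomposes (\<lambda>h\<in>carrier G. if h \<in> F then c h else \<zero>\<^bsub>S\<^esub>)"
    using F c by (intro decomposes) auto
  ultimately have "(\<lambda>h\<in>carrier G. if h \<in> {g} then ?x else \<zero>\<^bsub>S\<^esub>)
      = (\<lambda>h\<in>carrier G. if h \<in> F then c h else \<zero>\<^bsub>S\<^esub>)"
    using direct_sum[OF closed] by blast
  from fun_cong[OF this, of g] show ?thesis
    using g F by auto
qed

text \<open>Induction on \<open>n\<close>. If f = w a fixes the first n elements on the right and k
  fixes the defect v_n a - v_n a f, then f + k - f k fixes all n + 1 elements. Keeping the right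
  factor \<open>a\<close> explicit throughout leaves a multiplier \<open>w\<close> of degree inverse
  to \<open>g\<close>.\<close>

lemma common_right_identity:
  fixes n :: nat
  assumes reg: "von_neumann_regular (component_ring S C \<one>\<^bsub>G\<^esub>)"
    and g: "g \<in> carrier G" and a: "a \<in> C g" and v: "v \<in> {..<n} \<rightarrow> C (inv\<^bsub>G\<^esub> g)"
  shows "\<exists>w\<in>C (inv\<^bsub>G\<^esub> g). \<forall>i<n. v i \<otimes>\<^bsub>S\<^esub> a \<otimes>\<^bsub>S\<^esub> (w \<otimes>\<^bsub>S\<^esub> a) = v i \<otimes>\<^bsub>S\<^esub> a"
  using v
proof (induction n)
  case 0
  then show ?case
    using component_subgroup[of "inv\<^bsub>G\<^esub> g"] g additive_subgroup.zero_closed by fastforce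
next
  case (Suc n)
  let ?g' = "inv\<^bsub>G\<^esub> g"
  have g': "?g' \<in> carrier G" using g by simp
  from Suc obtain w where w: "w \<in> C ?g'"
    and IH: "\<And>i. i < n \<Longrightarrow> v i \<otimes>\<^bsub>S\<^esub> a \<otimes>\<^bsub>S\<^esub> (w \<otimes>\<^bsub>S\<^esub> a) = v i \<otimes>\<^bsub>S\<^esub> a"
    by (auto simp: Pi_iff)
  have vC: "v i \<in> C ?g'" if "i < Suc n" for i
    using Suc.prems that by auto
  have degree_one_mult: "x \<otimes>\<^bsub>S\<^esub> u \<in> C ?g'" if "x \<in> C \<one>\<^bsub>G\<^esub>" "u \<in> C ?g'" for x u
    using mult_in_component[OF G.one_closed g' that] g by simp
  have inv_mult: "u \<otimes>\<^bsub>S\<^esub> a \<in> C \<one>\<^bsub>G\<^esub>" if "u \<in> C ?g'" for u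
    using mult_in_component[OF g' g that a] g by simp
  \<comment> \<open>Formally v' = v_n (1 - a w), so that \<open>v'\<close> times \<open>a\<close> is
    the defect of v_n a under right multiplication by w a. It lies in S_e, where regularity supplies
    \<open>y\<close>.\<close>
  define v' where "v' = v n \<ominus>\<^bsub>S\<^esub> v n \<otimes>\<^bsub>S\<^esub> a \<otimes>\<^bsub>S\<^esub> w"
  have v': "v' \<in> C ?g'"
    unfolding v'_def using vC[of n] w g' inv_mult by (intro component_diff degree_one_mult) auto
  obtain y where y: "y \<in> C \<one>\<^bsub>G\<^esub>"
    and xyx: "v' \<otimes>\<^bsub>S\<^esub> a = v' \<otimes>\<^bsub>S\<^esub> a \<otimes>\<^bsub>S\<^esub> y \<otimes>\<^bsub>S\<^esub> (v' \<otimes>\<^bsub>S\<^esub> a)"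
    using reg inv_mult[OF v'] unfolding von_neumann_regular_def component_ring_def by auto
  have yv': "y \<otimes>\<^bsub>S\<^esub> v' \<in> C ?g'" using y v' by (rule degree_one_mult)
  have wayv': "w \<otimes>\<^bsub>S\<^esub> a \<otimes>\<^bsub>S\<^esub> (y \<otimes>\<^bsub>S\<^esub> v') \<in> C ?g'"
    using inv_mult[OF w] yv' by (rule degree_one_mult)
  \<comment> \<open>Obtained from f + k - f k, with f = w a and k = y v' a, by cancelling the common
    right factor \<open>a\<close>.\<close>
  define w' where "w' = w \<oplus>\<^bsub>S\<^esub> (y \<otimes>\<^bsub>S\<^esub> v' \<ominus>\<^bsub>S\<^esub> w \<otimes>\<^bsub>S\<^esub> a \<otimes>\<^bsub>S\<^esub> (y \<otimes>\<^bsub>S\<^esub> v'))"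
  have w': "w' \<in> C ?g'"
    unfolding w'_def using g' w yv' wayv' by (intro component_add component_diff)
  define k where "k = y \<otimes>\<^bsub>S\<^esub> v' \<otimes>\<^bsub>S\<^esub> a"
  note closed = component_closed[OF g a] component_closed[OF g' w] component_closed[OF g' v']
    component_closed[OF g' yv'] component_closed[OF G.one_closed y]
  have k: "k \<in> carrier S" unfolding k_def using closed by (intro S.m_closed)
  have w'a: "w' \<otimes>\<^bsub>S\<^esub> a = w \<otimes>\<^bsub>S\<^esub> a \<oplus>\<^bsub>S\<^esub> (k \<ominus>\<^bsub>S\<^esub> w \<otimes>\<^bsub>S\<^esub> a \<otimes>\<^bsub>S\<^esub> k)"
    unfolding w'_def k_def using closed
    by (simp add: S.l_distr S.l_distr_diff S.m_closed S.m_assoc)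
  have step: "v i \<otimes>\<^bsub>S\<^esub> a \<otimes>\<^bsub>S\<^esub> (w' \<otimes>\<^bsub>S\<^esub> a) = v i \<otimes>\<^bsub>S\<^esub> a \<otimes>\<^bsub>S\<^esub> (w \<otimes>\<^bsub>S\<^esub> a) \<oplus>\<^bsub>S\<^esub>
      (v i \<otimes>\<^bsub>S\<^esub> a \<ominus>\<^bsub>S\<^esub> v i \<otimes>\<^bsub>S\<^esub> a \<otimes>\<^bsub>S\<^esub> (w \<otimes>\<^bsub>S\<^esub> a)) \<otimes>\<^bsub>S\<^esub> k" if "i < Suc n" for i
    unfolding w'a using closed k component_closed[OF g' vC[OF that]]
    by (intro S.mult_circle_composition S.m_closed)
  have "v i \<otimes>\<^bsub>S\<^esub> a \<otimes>\<^bsub>S\<^esub> (w' \<otimes>\<^bsub>S\<^esub> a) = v i \<otimes>\<^bsub>S\<^esub> a" if "i < Suc n" for i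
  proof (cases "i = n")
    \<comment> \<open>For an earlier index the induction hypothesis makes the difference in
      \<open>step\<close> zero, so the term with \<open>k\<close> vanishes.\<close>
    case False
    then have "i < n" using that by simp
    then show ?thesis
      using step[OF that] IH[of i] k closed component_closed[OF g' vC[OF that]]
      by (simp add: S.m_closed S.l_null S.minus_eq S.r_neg)
  next
    case True
    note vn = component_closed[OF g' vC[of n]]
    \<comment> \<open>For the new index the difference is the defect v' a, and k = y v' a fixes it
      because v' a = (v' a) y (v' a). Adding the defect back restores v_n a.\<close>
    have v'a: "v n \<otimes>\<^bsub>S\<^esub> a \<ominus>\<^bsub>S\<^esub> v n \<otimes>\<^bsub>S\<^esub> a \<otimes>\<^bsub>S\<^esub> (w \<otimes>\<^bsub>S\<^esub> a) = v' \<otimes>\<^bsub>S\<^esub> a"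
      unfolding v'_def using closed vn by (simp add: S.l_distr_diff S.m_closed S.m_assoc)
    have "v' \<otimes>\<^bsub>S\<^esub> a \<otimes>\<^bsub>S\<^esub> k = v' \<otimes>\<^bsub>S\<^esub> a"
      using xyx closed unfolding k_def by (simp add: S.m_closed S.m_assoc)
    then have "v n \<otimes>\<^bsub>S\<^esub> a \<otimes>\<^bsub>S\<^esub> (w' \<otimes>\<^bsub>S\<^esub> a) = v n \<otimes>\<^bsub>S\<^esub> a \<otimes>\<^bsub>S\<^esub> (w \<otimes>\<^bsub>S\<^esub> a) \<oplus>\<^bsub>S\<^esub>
      (v n \<otimes>\<^bsub>S\<^esub> a \<ominus>\<^bsub>S\<^esub> v n \<otimes>\<^bsub>S\<^esub> a \<otimes>\<^bsub>S\<^esub> (w \<otimes>\<^bsub>S\<^esub> a))"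
      using step[of n] by (simp add: v'a)
    then show ?thesis
      using True closed vn by (simp add: S.add_diff_cancel_left S.m_closed)
  qed
  then show ?case using w' by blast
qed

lemma graded_regular_imp_component_regular:
  assumes "graded_von_neumann_regular G S C"
  shows "von_neumann_regular (component_ring S C \<one>\<^bsub>G\<^esub>)"
proof -
  have "\<exists>y\<in>C \<one>\<^bsub>G\<^esub>. a = a \<otimes>\<^bsub>S\<^esub> y \<otimes>\<^bsub>S\<^esub> a" if a: "a \<in> C \<one>\<^bsub>G\<^esub>" for a
  proof -
    obtain s where s: "s \<in> carrier S" and asa: "a = a \<otimes>\<^bsub>S\<^esub> s \<otimes>\<^bsub>S\<^esub> a"
      using assms a unfolding graded_von_neumann_regular_def by blast
    have aS: "a \<in> carrier S" using a component_closed by blast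
    obtain c where c: "c \<in> (\<Pi>\<^sub>E h\<in>carrier G. C h)"
      and fin: "finite {h \<in> carrier G. c h \<noteq> \<zero>\<^bsub>S\<^esub>}"
      and s_eq: "s = finsum S c {h \<in> carrier G. c h \<noteq> \<zero>\<^bsub>S\<^esub>}"
      using direct_sum[OF s] by blast
    \<comment> \<open>The neutral degree is inserted because \<open>c\<close> may vanish there,
      while \<open>homogeneous_sum_eq\<close> reads off the component at an index belonging to the
      set.\<close>
    let ?F = "insert \<one>\<^bsub>G\<^esub> {h \<in> carrier G. c h \<noteq> \<zero>\<^bsub>S\<^esub>}"
    have cC: "c h \<in> C h" if "h \<in> carrier G" for h using c that by blast
    then have cS: "c \<in> ?F \<rightarrow> carrier S" using component_closed by auto
    have F: "finite ?F" "?F \<subseteq> carrier G" using fin by auto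
    have "s = finsum S c ?F"
      unfolding s_eq using F cS by (intro S.add.finprod_mono_neutral_cong_left) auto
    then have a_eq: "a = (\<Oplus>\<^bsub>S\<^esub>h\<in>?F. a \<otimes>\<^bsub>S\<^esub> c h \<otimes>\<^bsub>S\<^esub> a)"
      using asa aS cS F S.finsum_rdistr[OF aS F(1) cS]
        S.finsum_ldistr[OF aS F(1), of "\<lambda>h. a \<otimes>\<^bsub>S\<^esub> c h"]
      by (simp add: Pi_iff S.m_closed)
    \<comment> \<open>Multiplying by the degree-e element \<open>a\<close> on both sides preserves
      degrees. The sum over \<open>?F\<close> is thus a homogeneous decomposition of
      \<open>a\<close>, and only the term of degree e survives.\<close>
    have "a \<otimes>\<^bsub>S\<^esub> c h \<otimes>\<^bsub>S\<^esub> a \<in> C h" if "h \<in> ?F" for h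
    proof -
      have h: "h \<in> carrier G" using that F by blast
      have "a \<otimes>\<^bsub>S\<^esub> c h \<in> C h"
        using mult_in_component[OF G.one_closed h a cC[OF h]] h by simp
      then show ?thesis
        using mult_in_component[OF h G.one_closed _ a] h by simp
    qed
    then have "(\<Oplus>\<^bsub>S\<^esub>h\<in>?F. a \<otimes>\<^bsub>S\<^esub> c h \<otimes>\<^bsub>S\<^esub> a) = a \<otimes>\<^bsub>S\<^esub> c \<one>\<^bsub>G\<^esub> \<otimes>\<^bsub>S\<^esub> a"
      using F a a_eq by (intro homogeneous_sum_eq) auto
    then show ?thesis using a_eq cC by auto
  qed
  then show ?thesis
    unfolding von_neumann_regular_def component_ring_def by simp
qed

lemma component_regular_imp_regular_at:
  assumes reg: "von_neumann_regular (component_ring S C \<one>\<^bsub>G\<^esub>)"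
    and g: "g \<in> carrier G" and a: "a \<in> C g"
    and \<epsilon>: "\<epsilon> \<in> finite_sums_of_products S (C g) (C (inv\<^bsub>G\<^esub> g))" and \<epsilon>a: "\<epsilon> \<otimes>\<^bsub>S\<^esub> a = a"
  shows "\<exists>w\<in>carrier S. a = a \<otimes>\<^bsub>S\<^esub> w \<otimes>\<^bsub>S\<^esub> a"
proof -
  obtain n :: nat and u v where u: "u \<in> {..<n} \<rightarrow> C g" and v: "v \<in> {..<n} \<rightarrow> C (inv\<^bsub>G\<^esub> g)"
    and \<epsilon>_eq: "\<epsilon> = (\<Oplus>\<^bsub>S\<^esub>i\<in>{..<n}. u i \<otimes>\<^bsub>S\<^esub> v i)"
    using \<epsilon> unfolding finite_sums_of_products_def by blast
  obtain w where w: "w \<in> C (inv\<^bsub>G\<^esub> g)"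
    and id: "\<And>i. i < n \<Longrightarrow> v i \<otimes>\<^bsub>S\<^esub> a \<otimes>\<^bsub>S\<^esub> (w \<otimes>\<^bsub>S\<^esub> a) = v i \<otimes>\<^bsub>S\<^esub> a"
    using common_right_identity[OF reg g a v] by blast
  have closed: "a \<in> carrier S" "w \<in> carrier S"
    "\<And>i. i < n \<Longrightarrow> u i \<in> carrier S" "\<And>i. i < n \<Longrightarrow> v i \<in> carrier S"
    using a w u v g component_closed[of g] component_closed[of "inv\<^bsub>G\<^esub> g"] by auto
  \<comment> \<open>Stated for general \<open>z\<close> since it is applied twice, to a w a and to
    a; \<open>id\<close> makes the two resulting sums agree term by term.\<close>
  have \<epsilon>_mult: "\<epsilon> \<otimes>\<^bsub>S\<^esub> z = (\<Oplus>\<^bsub>S\<^esub>i\<in>{..<n}. u i \<otimes>\<^bsub>S\<^esub> v i \<otimes>\<^bsub>S\<^esub> z)" if "z \<in> carrier S" for z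
    unfolding \<epsilon>_eq using that closed by (intro S.finsum_ldistr) (auto intro: S.m_closed)
  have "\<epsilon> \<otimes>\<^bsub>S\<^esub> (a \<otimes>\<^bsub>S\<^esub> (w \<otimes>\<^bsub>S\<^esub> a)) = (\<Oplus>\<^bsub>S\<^esub>i\<in>{..<n}. u i \<otimes>\<^bsub>S\<^esub> v i \<otimes>\<^bsub>S\<^esub> (a \<otimes>\<^bsub>S\<^esub> (w \<otimes>\<^bsub>S\<^esub> a)))"
    using closed by (intro \<epsilon>_mult S.m_closed)
  also have "\<dots> = (\<Oplus>\<^bsub>S\<^esub>i\<in>{..<n}. u i \<otimes>\<^bsub>S\<^esub> v i \<otimes>\<^bsub>S\<^esub> a)"
    using closed id by (intro S.finsum_cong') (auto simp: S.m_assoc S.m_closed)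
  also have "\<dots> = a"
    using \<epsilon>_mult[of a] \<epsilon>a closed by simp
  finally have "\<epsilon> \<otimes>\<^bsub>S\<^esub> (a \<otimes>\<^bsub>S\<^esub> (w \<otimes>\<^bsub>S\<^esub> a)) = a" .
  moreover have "\<epsilon> \<in> carrier S"
    unfolding \<epsilon>_eq using closed by (auto intro!: S.finsum_closed S.m_closed)
  \<comment> \<open>By associativity \<epsilon> (a w a) = (\<epsilon> a) w a = a w a, while the
    computation above gives \<epsilon> (a w a) = a.\<close>
  ultimately have "a = a \<otimes>\<^bsub>S\<^esub> w \<otimes>\<^bsub>S\<^esub> a"
    using \<epsilon>a closed by (metis S.m_assoc S.m_closed)
  then show ?thesis using closed by blast
qed

end

theorem corollary3p11:
  fixes G :: "('g, 'k) monoid_scheme" and S :: "('a, 'm) ring_scheme" and C :: "'g \<Rightarrow> 'a set"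
  assumes "epsilon_strongly_graded G S C"
  shows "graded_von_neumann_regular G S C \<longleftrightarrow>
    von_neumann_regular (component_ring S C \<one>\<^bsub>G\<^esub>)"
proof -
  interpret graded_ring G S C
    using assms unfolding epsilon_strongly_graded_def by blast
  obtain \<epsilon> where "\<And>g. g \<in> carrier G \<Longrightarrow>
      \<epsilon> g \<in> finite_sums_of_products S (C g) (C (inv\<^bsub>G\<^esub> g)) \<and> (\<forall>s\<in>C g. \<epsilon> g \<otimes>\<^bsub>S\<^esub> s = s)"
    using assms unfolding epsilon_strongly_graded_def by blast
  then show ?thesis
    using graded_regular_imp_component_regular component_regular_imp_regular_at
    unfolding graded_von_neumann_regular_def by metis
qed

end
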